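(* Let $m\ge 1$, let $a_1,\dots,a_m$ be scalar polynomials with $\deg a_l\le l$ for $l=1,\dots,m$, let $(\gamma_n)_{n\ge 0}$ be a sequence of numbers, and let $(p_n)_{n\ge 0}$ be a sequence of scalar polynomials satisfying, for all $n\ge 0$, $$\sum_{l=1}^m a_l(x)\,p_n^{(l)}(x)=\gamma_n\,p_n(x).$$ For $n\ge 0$ define the $2\times 2$ matrix polynomial $$P_n(x)=\begin{pmatrix} R_{2,0}(p_{2n})(x) & R_{2,1}(p_{2n})(x)\\ R_{2,0}(p_{2n+1})(x) & R_{2,1}(p_{2n+1})(x)\end{pmatrix}.$$ Then for all $n\ge 0$, $$\sum_{k=0}^m P_n^{(k)}(x)\,A_k(x)=\Gamma_n\,P_n(x),\qquad \Gamma_n=\begin{pmatrix}\gamma_{2n}&0\\0&\gamma_{2n+1}\end{pmatrix},$$ where the coefficients $A_k$, $k=0,\dots,m$ (which do not depend on $n$), are given by $$A_k=\sum_{l=\max(k,1)}^m C_{k,l},$$ $$C_{k,l}(x)=\begin{pmatrix} b_{k,l,0}(x)&b_{k,l,1}(x)\\ x\,b_{k,l,1}(x)+l\,b_{k,l-1,0}(x)& b_{k,l,0}(x)+l\,b_{k,l-1,1}(x)\end{pmatrix}\begin{pmatrix}a_{l,0}(x)&a_{l,1}(x)\\ x\,a_{l,1}(x)&a_{l,0}(x)\end{pmatrix},$$ $$b_{k,l}(x)=\left(\frac{(-1)^k}{k!}\sum_{j=[(l+1)/2]}^k(-1)^j\binom{k}{j}\,2j(2j-1)\cdots(2j-l+1)\right)x^{2k-l},$$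 with $b_{k,l,0}=R_{2,0}(b_{k,l})$, $b_{k,l,1}=R_{2,1}(b_{k,l})$, $a_{l,0}=R_{2,0}(a_l)$, $a_{l,1}=R_{2,1}(a_l)$.
   Context: Polynomials have real or complex coefficients and the $\gamma_n$ are real or complex numbers. For a scalar polynomial $p$ and $i\in\{0,1\}$, the polynomial $R_{2,i}(p)$ is defined by $$R_{2,i}(p)(x)=\sum_{s\ge 0}\frac{p^{(2s+i)}(0)}{(2s+i)!}\,x^s,$$ so that $p(x)=R_{2,0}(p)(x^2)+x\,R_{2,1}(p)(x^2)$. $[x]$ denotes the integer part of $x$. The product $2j(2j-1)\cdots(2j-l+1)$ has $l$ factors and equals $1$ when $l=0$. An empty sum is $0$; in particular $b_{k,l}$ is the zero polynomial when $2k<l$ (so no negative powers of $x$ occur). Also $b_{k,l}=0$ when $k>l$. $P_n^{(k)}$ denotes the entrywise $k$-th derivative of $P_n$; the matrix coefficients $A_k(x)$ multiply on the right, the eigenvalue $\Gamma_n$ on the left. *)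

theory Defs
  imports "HOL-Analysis.Analysis" "HOL-Computational_Algebra.Polynomial"
begin

text \<open>The sum over all \<open>s \<ge> 0\<close> is cut at \<open>degree p\<close>; the remaining terms
  vanish, see \<open>coeff_R2\<close> below.\<close>

definition R2 :: "nat \<Rightarrow> 'a::field_char_0 poly \<Rightarrow> 'a poly" where
  "R2 i p = (\<Sum>s\<le>degree p. monom (poly ((pderiv ^^ (2 * s + i)) p) 0 / fact (2 * s + i)) s)"

lemma coeff_R2: "coeff (R2 i p) s = coeff p (2 * s + i)"
proof -
  have c: "poly ((pderiv ^^ n) p) 0 / fact n = coeff p n" for n
    by (simp add: poly_0_coeff_0 coeff_higher_pderiv flip: pochhammer_fact)
  show ?thesis
    unfolding R2_def c
    by (cases "s \<le> degree p") (auto simp: coeff_sum coeff_eq_0)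
qed

lemma R2_decomposition:
  "p = pcompose (R2 0 p) (monom 1 2) + monom 1 1 * pcompose (R2 1 p) (monom 1 2)"
proof (rule poly_eqI)
  fix n
  have c: "coeff (pcompose q (monom 1 2)) n = (if even n then coeff q (n div 2) else 0)"
    for q :: "'a poly" and n
  proof (induction q arbitrary: n)
    case (pCons b q)
    show ?case
    proof (cases "n < 2")
      case True
      then have "n = 0 \<or> n = 1" by auto
      then show ?thesis by (auto simp: pcompose_pCons coeff_monom_mult)
    next
      case False
      then obtain k where "n = Suc (Suc k)"
        by (metis add_2_eq_Suc le_Suc_ex not_less)
      then show ?thesis by (simp add: pcompose_pCons coeff_monom_mult pCons.IH)
    qed
  qed simp
  show "coeff p n = coeff (pcompose (R2 0 p) (monom 1 2)
          + monom 1 1 * pcompose (R2 1 p) (monom 1 2)) n"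
    unfolding coeff_add coeff_monom_mult c coeff_R2 by (auto elim!: evenE oddE)
qed

text \<open>Matrix polynomials are matrices with polynomial entries.\<close>

definition mat2 :: "'b::zero \<Rightarrow> 'b \<Rightarrow> 'b \<Rightarrow> 'b \<Rightarrow> 'b ^ 2 ^ 2" where
  "mat2 a b c d = vector [vector [a, b], vector [c, d]]"

definition mat_pderiv :: "'a::field_char_0 poly ^ 'n ^ 'm \<Rightarrow> 'a poly ^ 'n ^ 'm" where
  "mat_pderiv M = (\<chi> i j. pderiv (M $ i $ j))"

definition Pmat :: "(nat \<Rightarrow> 'a::field_char_0 poly) \<Rightarrow> nat \<Rightarrow> 'a poly ^ 2 ^ 2" where
  "Pmat p n = mat2 (R2 0 (p (2*n)))   (R2 1 (p (2*n)))
                   (R2 0 (p (2*n+1))) (R2 1 (p (2*n+1)))"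

definition Gam :: "(nat \<Rightarrow> 'a::field_char_0) \<Rightarrow> nat \<Rightarrow> 'a poly ^ 2 ^ 2" where
  "Gam \<gamma> n = mat2 [:\<gamma> (2*n):] 0 0 [:\<gamma> (2*n+1):]"

text \<open>When \<open>2*k < l\<close> the exponent \<open>2*k - l\<close> is truncated to 0, but then the
  sum over \<open>j\<close> is empty and the polynomial is 0.\<close>

definition bpoly :: "nat \<Rightarrow> nat \<Rightarrow> 'a::field_char_0 poly" where
  "bpoly k l = monom ((-1) ^ k / fact k *
     (\<Sum>j = (l+1) div 2..k. (-1) ^ j * of_nat (k choose j) *
        (\<Prod>i<l. of_nat (2*j) - of_nat i))) (2*k - l)"

text \<open>Only used for \<open>l \<ge> 1\<close>.\<close>

definition Cmat :: "(nat \<Rightarrow> 'a::field_char_0 poly) \<Rightarrow> nat \<Rightarrow> nat \<Rightarrow> 'a poly ^ 2 ^ 2" where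
  "Cmat a k l =
     mat2 (R2 0 (bpoly k l))
          (R2 1 (bpoly k l))
          (monom 1 1 * R2 1 (bpoly k l) + of_nat l * R2 0 (bpoly k (l-1)))
          (R2 0 (bpoly k l) + of_nat l * R2 1 (bpoly k (l-1)))
     ** mat2 (R2 0 (a l))
             (R2 1 (a l))
             (monom 1 1 * R2 1 (a l))
             (R2 0 (a l))"

definition Amat :: "nat \<Rightarrow> (nat \<Rightarrow> 'a::field_char_0 poly) \<Rightarrow> nat \<Rightarrow> 'a poly ^ 2 ^ 2" where
  "Amat m a k = (\<Sum>l = max k 1..m. Cmat a k l)"

end

theory Submission
  imports Defs
begin

text \<open>Split \<open>p\<close> as \<open>u(x\<^sup>2) + x v(x\<^sup>2)\<close>. The coefficients \<open>b\<^sub>k\<^sub>,\<^sub>l\<close> are exactly those of the chain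
  rule \<open>(u(x\<^sup>2))\<^sup>(\<^sup>l\<^sup>) = \<Sum>k. u\<^sup>(\<^sup>k\<^sup>)(x\<^sup>2) b\<^sub>k\<^sub>,\<^sub>l(x)\<close>: both sides satisfy
  \<open>b\<^sub>k\<^sub>,\<^sub>l\<^sub>+\<^sub>1 = b\<^sub>k\<^sub>,\<^sub>l' + 2x b\<^sub>k\<^sub>-\<^sub>1\<^sub>,\<^sub>l\<close>. With Leibniz' rule for the summand \<open>x v(x\<^sup>2)\<close> this expresses
  \<open>a\<^sub>l p\<^sup>(\<^sup>l\<^sup>)\<close> through the derivatives of \<open>u\<close> and \<open>v\<close>, and separating even and odd parts gives the
  rows of the matrix identity.\<close>

section \<open>Even and odd parts under sums, products and multiplication by x\<close>

lemma coeff_pcompose_square: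
  "coeff (pcompose q (monom 1 2)) n = (if even n then coeff q (n div 2) else 0)"
  for q :: "'a::comm_semiring_1 poly"
proof (induction q arbitrary: n)
  case (pCons b q)
  consider "n = 0" | "n = 1" | k where "n = Suc (Suc k)"
    by (metis One_nat_def not0_implies_Suc)
  then show ?case
    by cases (simp_all add: pcompose_pCons coeff_monom_mult pCons.IH)
qed simp

lemma R2_add: "R2 i (f + g) = R2 i f + R2 i g"
  by (rule poly_eqI) (simp add: coeff_R2)

lemma R2_zero: "R2 i 0 = 0"
  by (rule poly_eqI) (simp add: coeff_R2)

lemma R2_sum: "R2 i (sum f A) = (\<Sum>x\<in>A. R2 i (f x))"
  by (induction A rule: infinite_finite_induct) (simp_all add: R2_add R2_zero)

lemma R2_smult: "R2 i (smult c f) = smult c (R2 i f)"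
  by (rule poly_eqI) (simp add: coeff_R2)

lemma R2_0_monom_mult: "R2 0 (monom 1 1 * f) = monom 1 1 * R2 1 f"
proof (rule poly_eqI)
  show "coeff (R2 0 (monom 1 1 * f)) n = coeff (monom 1 1 * R2 1 f) n" for n
    by (cases n) (simp_all add: coeff_R2 coeff_monom_mult)
qed

lemma R2_1_monom_mult: "R2 1 (monom 1 1 * f) = R2 0 f"
  by (rule poly_eqI) (auto simp: coeff_R2 coeff_monom_mult)

lemma R2_0_pcompose_square: "R2 0 (pcompose u (monom 1 2)) = u"
  by (rule poly_eqI) (simp add: coeff_R2 coeff_pcompose_square)

lemma R2_1_pcompose_square: "R2 1 (pcompose u (monom 1 2)) = 0"
  by (rule poly_eqI) (simp add: coeff_R2 coeff_pcompose_square)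

text \<open>A factor in x^2 is even, so it does not mix the even and odd parts of
  \<open>f\<close>.\<close>

lemma R2_pcompose_square_mult:
  assumes "i < 2"
  shows "R2 i (pcompose u (monom 1 2) * f) = u * R2 i f"
proof -
  let ?E = "\<lambda>q. pcompose q (monom 1 2)" and ?X = "monom 1 1 :: 'a poly"
  have "?E u * f = ?E u * (?E (R2 0 f) + ?X * ?E (R2 1 f))"
    using R2_decomposition[of f] by simp
  also have "\<dots> = ?E (u * R2 0 f) + ?X * ?E (u * R2 1 f)"
    by (simp add: pcompose_mult algebra_simps)
  finally have e: "?E u * f = ?E (u * R2 0 f) + ?X * ?E (u * R2 1 f)" .
  have "i = 0 \<or> i = 1"
    using assms by auto
  then show ?thesis
    unfolding e
    by (auto simp only: R2_add R2_0_monom_mult R2_1_monom_mult R2_0_pcompose_square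
        R2_1_pcompose_square mult_zero_right add_0_right add_0_left)
qed

text \<open>Two odd parts multiply to x^2, which is a single \<open>monom 1 1\<close> after passing
  to the new variable. This accounts for the right factor in \<open>Cmat\<close>.\<close>

lemma R2_mult:
  "R2 0 (f * g) = R2 0 f * R2 0 g + monom 1 1 * (R2 1 f * R2 1 g)"
  "R2 1 (f * g) = R2 0 f * R2 1 g + R2 1 f * R2 0 g"
proof -
  let ?E = "\<lambda>q. pcompose q (monom 1 2)" and ?X = "monom 1 1 :: 'a poly"
  have "f * g = (?E (R2 0 f) + ?X * ?E (R2 1 f)) * g"
    using R2_decomposition[of f] by simp
  also have "\<dots> = ?E (R2 0 f) * g + ?X * (?E (R2 1 f) * g)"
    by (simp add: algebra_simps)
  finally have e: "f * g = ?E (R2 0 f) * g + ?X * (?E (R2 1 f) * g)" .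
  show "R2 0 (f * g) = R2 0 f * R2 0 g + monom 1 1 * (R2 1 f * R2 1 g)"
    "R2 1 (f * g) = R2 0 f * R2 1 g + R2 1 f * R2 0 g"
    unfolding e R2_add R2_0_monom_mult R2_1_monom_mult
    by (simp_all add: R2_pcompose_square_mult)
qed

section \<open>The chain rule coefficients and their recurrence\<close>

text \<open>This is the l-th derivative of (x^2 - 1)^k / k! at x = 1. The sum starts at j = 0 so
  that its range is independent of \<open>l\<close> in the recurrence.\<close>

definition bcoeff :: "nat \<Rightarrow> nat \<Rightarrow> 'a::field_char_0" where
  "bcoeff k l = (-1) ^ k / fact k *
     (\<Sum>j\<le>k. (-1) ^ j * of_nat (k choose j) * (\<Prod>i<l. of_nat (2*j) - of_nat i))"

lemma prod_of_nat_diff_eq_0: "n < l \<Longrightarrow> (\<Prod>i<l. of_nat n - of_nat i :: 'a::field_char_0) = 0"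
  by (rule prod_zero) auto

lemma bpoly_eq_monom: "bpoly k l = monom (bcoeff k l :: 'a::field_char_0) (2*k - l)"
proof -
  have "(\<Sum>j = (l+1) div 2..k. (-1) ^ j * of_nat (k choose j) * (\<Prod>i<l. of_nat (2*j) - of_nat i))
    = (\<Sum>j\<le>k. (-1) ^ j * of_nat (k choose j) * (\<Prod>i<l. of_nat (2*j) - of_nat i) :: 'a)"
  proof (rule sum.mono_neutral_left, goal_cases)
    case 3
    show ?case
    proof
      fix j assume "j \<in> {..k} - {(l+1) div 2..k}"
      \<comment> \<open>\<open>(l+1) div 2\<close> is l/2 rounded up, so for smaller
        \<open>j\<close> the product contains the factor 0.\<close>
      then have "2*j < l" by auto
      then have "(\<Prod>i<l. of_nat (2*j) - of_nat i :: 'a) = 0"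
        by (rule prod_of_nat_diff_eq_0)
      then show "(-1) ^ j * of_nat (k choose j) * (\<Prod>i<l. of_nat (2*j) - of_nat i :: 'a) = 0"
        by (simp only: mult_zero_right)
    qed
  qed auto
  then show ?thesis
    by (simp add: bpoly_def bcoeff_def)
qed

text \<open>Makes the truncated exponent \<open>2*k - l\<close> harmless: the coefficient is 0
  whenever truncation happens.\<close>

lemma bcoeff_eq_0:
  assumes "2*k < l"
  shows "bcoeff k l = (0 :: 'a::field_char_0)"
proof -
  have "(\<Prod>i<l. of_nat (2*j) - of_nat i :: 'a) = 0" if "j \<le> k" for j
    using that assms by (intro prod_of_nat_diff_eq_0) simp
  then have "(\<Sum>j\<le>k. (-1) ^ j * of_nat (k choose j) * (\<Prod>i<l. of_nat (2*j) - of_nat i)) = (0 :: 'a)"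
    by (intro sum.neutral ballI) (simp only: atMost_iff mult_zero_right)
  then show ?thesis
    by (simp only: bcoeff_def mult_zero_right)
qed

lemma bcoeff_0_0: "bcoeff 0 0 = 1"
  by (simp add: bcoeff_def)

lemma bcoeff_Suc_0: "bcoeff (Suc k) 0 = (0 :: 'a::field_char_0)"
  using choose_alternating_sum[of "Suc k", where ?'a = 'a] by (simp add: bcoeff_def)

lemma bcoeff_0_Suc: "bcoeff 0 (Suc l) = 0"
  by (simp add: bcoeff_eq_0)

text \<open>Write the new factor \<open>2j - l\<close> as \<open>(2(k+1) - l) - 2(k+1-j)\<close> and absorb \<open>k+1-j\<close> into the
  binomial coefficient.\<close>

lemma bcoeff_Suc_Suc:
  "bcoeff (Suc k) (Suc l)
    = (of_nat (2 * Suc k) - of_nat l) * bcoeff (Suc k) l + 2 * (bcoeff k l :: 'a::field_char_0)"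
proof -
  define F where "F j = (\<Prod>i<l. of_nat (2*j) - of_nat i :: 'a)" for j
  define T where "T n = (\<Sum>j\<le>n. (-1) ^ j * of_nat (n choose j) * F j)" for n
  have absorb: "of_nat (Suc k choose j) * (of_nat (Suc k) - of_nat j :: 'a)
    = of_nat (Suc k) * of_nat (k choose j)" if "j \<le> Suc k" for j
  proof -
    have "(Suc k - j) * (Suc k choose j) = Suc k * (k choose j)"
      using binomial_absorb_comp[of "Suc k" j] by simp
    from arg_cong[OF this, of "of_nat :: nat \<Rightarrow> 'a"] show ?thesis
      unfolding of_nat_mult of_nat_diff[OF that] by (simp only: mult.commute)
  qed
  have "(\<Sum>j\<le>Suc k. (-1) ^ j * of_nat (Suc k choose j) * (F j * (of_nat (2*j) - of_nat l)))
    = (\<Sum>j\<le>Suc k. (of_nat (2 * Suc k) - of_nat l) * ((-1) ^ j * of_nat (Suc k choose j) * F j)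
        - 2 * of_nat (Suc k) * ((-1) ^ j * of_nat (k choose j) * F j))"
  proof (rule sum.cong[OF refl])
    fix j assume "j \<in> {..Suc k}"
    then have ab: "of_nat (Suc k choose j) * (of_nat (Suc k) - of_nat j :: 'a)
      = of_nat (Suc k) * of_nat (k choose j)" by (intro absorb) simp
    have "(-1) ^ j * of_nat (Suc k choose j) * (F j * (of_nat (2*j) - of_nat l))
      = (of_nat (2 * Suc k) - of_nat l) * ((-1) ^ j * of_nat (Suc k choose j) * F j)
        - 2 * (of_nat (Suc k choose j) * (of_nat (Suc k) - of_nat j)) * ((-1) ^ j * F j)"
      by (simp add: algebra_simps del: binomial_Suc_Suc)
    also have "\<dots> = (of_nat (2 * Suc k) - of_nat l) * ((-1) ^ j * of_nat (Suc k choose j) * F j)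
        - 2 * of_nat (Suc k) * ((-1) ^ j * of_nat (k choose j) * F j)"
      unfolding ab by (simp only: mult_ac)
    finally show "(-1) ^ j * of_nat (Suc k choose j) * (F j * (of_nat (2*j) - of_nat l))
      = (of_nat (2 * Suc k) - of_nat l) * ((-1) ^ j * of_nat (Suc k choose j) * F j)
        - 2 * of_nat (Suc k) * ((-1) ^ j * of_nat (k choose j) * F j)" .
  qed
  \<comment> \<open>The second sum also runs to \<open>Suc k\<close>, but its last term vanishes
    because \<open>k choose Suc k\<close> is 0.\<close>
  also have "\<dots> = (of_nat (2 * Suc k) - of_nat l) * T (Suc k) - 2 * of_nat (Suc k) * T k"
    by (simp add: T_def sum_subtractf sum_distrib_left del: binomial_Suc_Suc sum.atMost_Suc of_nat_Suc)
       (simp add: binomial_eq_0)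
  finally have S: "(\<Sum>j\<le>Suc k. (-1) ^ j * of_nat (Suc k choose j) * (F j * (of_nat (2*j) - of_nat l)))
    = (of_nat (2 * Suc k) - of_nat l) * T (Suc k) - 2 * of_nat (Suc k) * T k" .
  have B: "bcoeff n l = (-1) ^ n / fact n * T n" for n
    by (simp add: bcoeff_def T_def F_def)
  have "bcoeff (Suc k) (Suc l) = (-1) ^ Suc k / fact (Suc k) *
      (\<Sum>j\<le>Suc k. (-1) ^ j * of_nat (Suc k choose j) * (F j * (of_nat (2*j) - of_nat l)))"
    unfolding bcoeff_def F_def prod.lessThan_Suc ..
  \<comment> \<open>The factor \<open>- 2 * of_nat (Suc k)\<close> turns the prefactor for
    \<open>Suc k\<close> into twice the one for \<open>k\<close>, sign included.\<close>
  also have "\<dots> = (of_nat (2 * Suc k) - of_nat l) * bcoeff (Suc k) l + 2 * bcoeff k l"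
  proof -
    have "(of_nat (Suc k) :: 'a) \<noteq> 0"
      by (rule of_nat_neq_0)
    then show ?thesis
      unfolding S B by (simp add: fact_Suc divide_simps del: of_nat_Suc) (simp add: algebra_simps)
  qed
  finally show ?thesis .
qed

lemma bpoly_0_0: "bpoly 0 0 = 1"
  by (simp add: bpoly_eq_monom bcoeff_0_0)

lemma bpoly_0_Suc: "bpoly 0 (Suc l) = 0"
  by (simp add: bpoly_eq_monom bcoeff_0_Suc)

lemma pderiv_bpoly_0: "pderiv (bpoly 0 l) = 0"
  by (simp add: bpoly_eq_monom pderiv_monom)

text \<open>Differentiating x^(2(k+1)-l) produces the first factor in the recurrence for
  \<open>bcoeff\<close>, and 2x raises the exponent 2k-l to the same value 2k+1-l.\<close>

lemma bpoly_Suc_Suc: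
  "bpoly (Suc k) (Suc l)
    = pderiv (bpoly (Suc k) l) + monom 2 1 * (bpoly k l :: 'a::field_char_0 poly)"
proof -
  have "pderiv (bpoly (Suc k) l :: 'a poly)
    = monom ((of_nat (2 * Suc k) - of_nat l) * bcoeff (Suc k) l) (2 * Suc k - Suc l)"
    by (cases "l \<le> 2 * Suc k")
       (simp_all add: bpoly_eq_monom pderiv_monom of_nat_diff bcoeff_eq_0 del: mult_Suc_right)
  moreover have "monom 2 1 * (bpoly k l :: 'a poly) = monom (2 * bcoeff k l) (2 * Suc k - Suc l)"
    by (cases "l \<le> 2 * k") (simp_all add: bpoly_eq_monom mult_monom Suc_diff_le bcoeff_eq_0)
  ultimately show ?thesis
    by (simp only: bpoly_eq_monom[of "Suc k" "Suc l"] bcoeff_Suc_Suc add_monom)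
qed

text \<open>The alternating binomial sum gives l = 0; the recurrence lowers \<open>k\<close> by at
  most one for each step in \<open>l\<close>.\<close>

lemma bpoly_eq_0: "l < k \<Longrightarrow> bpoly k l = 0"
proof (induction l arbitrary: k)
  case 0
  then show ?case
    by (cases k) (simp_all add: bpoly_eq_monom bcoeff_Suc_0)
next
  case (Suc l)
  then show ?case
    by (cases k) (simp_all add: bpoly_Suc_Suc)
qed

section \<open>Higher derivatives of the even and odd parts\<close>

lemma higher_pderiv_pcompose_square:
  "(pderiv ^^ l) (pcompose u (monom 1 2))
    = (\<Sum>k\<le>l. pcompose ((pderiv ^^ k) u) (monom 1 2) * bpoly k l)"
proof (induction l)
  case 0
  show ?case
    by (simp add: bpoly_0_0)
next
  case (Suc l)
  define D where "D k = pcompose ((pderiv ^^ k) u) (monom 1 2)" for k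
  have D: "pderiv (D k) = D (Suc k) * monom 2 1" for k
    by (simp add: D_def pderiv_pcompose pderiv_monom)
  have "(pderiv ^^ Suc l) (pcompose u (monom 1 2)) = pderiv (\<Sum>k\<le>l. D k * bpoly k l)"
    using Suc.IH by (simp add: D_def)
  also have "\<dots> = (\<Sum>k\<le>l. D k * pderiv (bpoly k l)) + (\<Sum>k\<le>l. D (Suc k) * (monom 2 1 * bpoly k l))"
    by (simp add: higher_pderiv_sum[of 1, simplified] pderiv_mult D sum.distrib algebra_simps)
  \<comment> \<open>Adding the zero term k = l+1 and then dropping k = 0, where \<open>bpoly\<close>
    is constant, aligns this sum with the one in \<open>D (Suc k)\<close>.\<close>
  also have "(\<Sum>k\<le>l. D k * pderiv (bpoly k l)) = (\<Sum>k\<le>Suc l. D k * pderiv (bpoly k l))"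
    by (simp add: bpoly_eq_0)
  also have "\<dots> = (\<Sum>k\<le>l. D (Suc k) * pderiv (bpoly (Suc k) l))"
    by (simp add: sum.atMost_Suc_shift pderiv_bpoly_0 del: sum.atMost_Suc)
  also have "\<dots> + (\<Sum>k\<le>l. D (Suc k) * (monom 2 1 * bpoly k l))
    = (\<Sum>k\<le>l. D (Suc k) * bpoly (Suc k) (Suc l))"
    by (simp add: bpoly_Suc_Suc sum.distrib algebra_simps)
  also have "\<dots> = (\<Sum>k\<le>Suc l. D k * bpoly k (Suc l))"
    by (simp add: sum.atMost_Suc_shift bpoly_0_Suc del: sum.atMost_Suc)
  finally show ?case
    by (simp add: D_def)
qed

lemma higher_pderiv_monom_mult:
  "(pderiv ^^ l) (monom 1 1 * f)
    = monom 1 1 * (pderiv ^^ l) f + of_nat l * (pderiv ^^ (l - 1)) f"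
  for f :: "'a::field_char_0 poly"
proof (induction l)
  case (Suc l)
  \<comment> \<open>For l = 0 the truncated \<open>l - 1\<close> is masked by the factor 0.\<close>
  have "of_nat l * pderiv ((pderiv ^^ (l - 1)) f) = of_nat l * (pderiv ^^ l) f"
    by (cases l) simp_all
  moreover have "(pderiv ^^ Suc l) (monom 1 1 * f)
    = pderiv (monom 1 1 * (pderiv ^^ l) f + of_nat l * (pderiv ^^ (l - 1)) f)"
    by (simp only: funpow.simps o_apply Suc.IH)
  ultimately show ?case
    by (simp add: pderiv_add pderiv_mult pderiv_monom algebra_simps)
qed simp

lemma higher_pderiv_decomposition:
  assumes "l \<ge> 1"
  shows "(pderiv ^^ l) q = (\<Sum>k\<le>l. pcompose ((pderiv ^^ k) (R2 0 q)) (monom 1 2) * bpoly k l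
    + pcompose ((pderiv ^^ k) (R2 1 q)) (monom 1 2)
      * (monom 1 1 * bpoly k l + of_nat l * bpoly k (l - 1)))"
proof -
  let ?E = "\<lambda>q. pcompose q (monom 1 2)"
  \<comment> \<open>The added term k = l is 0, so all the sums share one range.\<close>
  have low: "(pderiv ^^ (l - 1)) (?E (R2 1 q)) = (\<Sum>k\<le>l. ?E ((pderiv ^^ k) (R2 1 q)) * bpoly k (l - 1))"
    using assms unfolding higher_pderiv_pcompose_square
    by (intro sum.mono_neutral_left) (auto simp: bpoly_eq_0)
  have "(pderiv ^^ l) q = (pderiv ^^ l) (?E (R2 0 q) + monom 1 1 * ?E (R2 1 q))"
    using R2_decomposition[of q] by simp
  also have "\<dots> = (pderiv ^^ l) (?E (R2 0 q)) + (monom 1 1 * (pderiv ^^ l) (?E (R2 1 q))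
      + of_nat l * (pderiv ^^ (l - 1)) (?E (R2 1 q)))"
    by (simp only: higher_pderiv_add higher_pderiv_monom_mult)
  also have "\<dots> = (\<Sum>k\<le>l. ?E ((pderiv ^^ k) (R2 0 q)) * bpoly k l
    + ?E ((pderiv ^^ k) (R2 1 q)) * (monom 1 1 * bpoly k l + of_nat l * bpoly k (l - 1)))"
    unfolding low unfolding higher_pderiv_pcompose_square
    by (simp add: sum.distrib sum_distrib_left algebra_simps)
  finally show ?thesis .
qed

section \<open>Assembling the matrix identity entry by entry\<close>

lemma mat2_nth:
  "mat2 a b c d $ 1 $ 1 = a" "mat2 a b c d $ 1 $ 2 = b"
  "mat2 a b c d $ 2 $ 1 = c" "mat2 a b c d $ 2 $ 2 = d"
  by (simp_all add: mat2_def)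

lemma R2_of_nat_mult: "R2 i (of_nat n * f) = of_nat n * R2 i f"
  by (simp add: of_nat_poly R2_smult)

lemma R2_mult_higher_pderiv:
  assumes "l \<ge> 1"
  shows "R2 0 (a l * (pderiv ^^ l) q) = (\<Sum>k\<le>l. (pderiv ^^ k) (R2 0 q) * Cmat a k l $ 1 $ 1
      + (pderiv ^^ k) (R2 1 q) * Cmat a k l $ 2 $ 1)"
    and "R2 1 (a l * (pderiv ^^ l) q) = (\<Sum>k\<le>l. (pderiv ^^ k) (R2 0 q) * Cmat a k l $ 1 $ 2
      + (pderiv ^^ k) (R2 1 q) * Cmat a k l $ 2 $ 2)"
proof -
  have R: "R2 i ((pderiv ^^ l) q) = (\<Sum>k\<le>l. (pderiv ^^ k) (R2 0 q) * R2 i (bpoly k l)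
      + (pderiv ^^ k) (R2 1 q) * (R2 i (monom 1 1 * bpoly k l) + of_nat l * R2 i (bpoly k (l - 1))))"
    if "i < 2" for i
    unfolding higher_pderiv_decomposition[OF assms, of q] R2_sum R2_add
      R2_pcompose_square_mult[OF that] R2_of_nat_mult ..
  \<comment> \<open>The coefficients in \<open>R0\<close> and \<open>R1\<close> are the two columns
    of the left factor of \<open>Cmat\<close>.\<close>
  note R0 = R[of 0, OF pos2, unfolded R2_0_monom_mult]
    and R1 = R[of 1, OF less_2_cases_iff[THEN iffD2, OF disjI2, OF One_nat_def], unfolded R2_1_monom_mult]
  show "R2 0 (a l * (pderiv ^^ l) q) = (\<Sum>k\<le>l. (pderiv ^^ k) (R2 0 q) * Cmat a k l $ 1 $ 1
      + (pderiv ^^ k) (R2 1 q) * Cmat a k l $ 2 $ 1)"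
    "R2 1 (a l * (pderiv ^^ l) q) = (\<Sum>k\<le>l. (pderiv ^^ k) (R2 0 q) * Cmat a k l $ 1 $ 2
      + (pderiv ^^ k) (R2 1 q) * Cmat a k l $ 2 $ 2)"
    unfolding R2_mult R0 R1 Cmat_def matrix_matrix_mult_def
    by (simp_all only: vec_lambda_beta sum_2 mat2_nth sum_distrib_left sum.distrib[symmetric])
       (rule sum.cong[OF refl], simp only: ring_distribs add_ac mult_ac)+
qed

text \<open>Interchanges summation over the pairs with 1 \<le> l \<le> m and k \<le> l, collecting
  the terms that come from one \<open>a l\<close>.\<close>

lemma sum_mult_Amat:
  "(\<Sum>k=0..m. u k * Amat m a k $ i $ j) = (\<Sum>l=1..m. \<Sum>k\<le>l. u k * Cmat a k l $ i $ j)"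
proof -
  have "(\<Sum>k=0..m. u k * Amat m a k $ i $ j)
    = (\<Sum>k=0..m. \<Sum>l | l \<in> {1..m} \<and> k \<le> l. u k * Cmat a k l $ i $ j)"
  proof (rule sum.cong[OF refl])
    fix k
    have "{max k 1..m} = {l. l \<in> {1..m} \<and> k \<le> l}"
      by auto
    then show "u k * Amat m a k $ i $ j = (\<Sum>l | l \<in> {1..m} \<and> k \<le> l. u k * Cmat a k l $ i $ j)"
      by (simp add: Amat_def sum_distrib_left)
  qed
  also have "\<dots> = (\<Sum>l=1..m. \<Sum>k | k \<in> {0..m} \<and> k \<le> l. u k * Cmat a k l $ i $ j)"
    by (rule sum.swap_restrict) simp_all
  also have "\<dots> = (\<Sum>l=1..m. \<Sum>k\<le>l. u k * Cmat a k l $ i $ j)"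
    by (intro sum.cong) auto
  finally show ?thesis .
qed

lemma row_equation:
  assumes "(\<Sum>l=1..m. a l * (pderiv ^^ l) q) = smult c q"
  shows "(\<Sum>k=0..m. (pderiv ^^ k) (R2 0 q) * Amat m a k $ 1 $ 1
      + (pderiv ^^ k) (R2 1 q) * Amat m a k $ 2 $ 1) = smult c (R2 0 q)"
    and "(\<Sum>k=0..m. (pderiv ^^ k) (R2 0 q) * Amat m a k $ 1 $ 2
      + (pderiv ^^ k) (R2 1 q) * Amat m a k $ 2 $ 2) = smult c (R2 1 q)"
  unfolding R2_smult[symmetric] assms[symmetric] R2_sum
  \<comment> \<open>The contributions of the two parts are separated for the interchange, then
    rejoined.\<close>
  unfolding sum.distrib sum_mult_Amat unfolding sum.distrib[symmetric]
  by (intro sum.cong refl R2_mult_higher_pderiv[symmetric]; simp)+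

lemma mat_pderiv_funpow_nth: "(mat_pderiv ^^ k) M $ i $ j = (pderiv ^^ k) (M $ i $ j)"
  by (induction k) (simp_all add: mat_pderiv_def)

theorem theorem3p1:
  fixes m :: nat
    and a :: "nat \<Rightarrow> 'a::real_normed_field poly"
    and \<gamma> :: "nat \<Rightarrow> 'a"
    and p :: "nat \<Rightarrow> 'a poly"
  assumes "m \<ge> 1"
    and "\<And>l. 1 \<le> l \<Longrightarrow> l \<le> m \<Longrightarrow> degree (a l) \<le> l"
    and "\<And>n. (\<Sum>l=1..m. a l * (pderiv ^^ l) (p n)) = smult (\<gamma> n) (p n)"
  shows "\<forall>n. (\<Sum>k=0..m. (mat_pderiv ^^ k) (Pmat p n) ** Amat m a k) = Gam \<gamma> n ** Pmat p n"
proof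
  fix n
  \<comment> \<open>As \<open>Gam\<close> is diagonal, each row of the identity involves just one of
    these two polynomials.\<close>
  note rows = row_equation[OF assms(3)[of "2 * n"]] row_equation[OF assms(3)[of "2 * n + 1"]]
  show "(\<Sum>k=0..m. (mat_pderiv ^^ k) (Pmat p n) ** Amat m a k) = Gam \<gamma> n ** Pmat p n"
    unfolding vec_eq_iff forall_2 sum_component matrix_matrix_mult_def vec_lambda_beta sum_2
      mat_pderiv_funpow_nth Pmat_def Gam_def mat2_nth rows
    by simp
qed

end
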